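(* Let $V$ be a finite-dimensional real inner product space, $\Omega\subseteq V$ a full-dimensional lattice, $d\in\mathbb{N}$, and $\mathcal{W}\subseteq\mathrm{GL}(V)$ a finite group with $s(\Omega)=\Omega$ and $s(\Omega_d)=\Omega_d$ for all $s\in\mathcal{W}$. For $s\in\mathcal{W}$ let $\vartheta(s)$ be the permutation matrix on $\mathbb{C}^{\Omega_d}$ given by $(\vartheta(s)\,\mathbf{x})_\mu:=\mathbf{x}_{s^{-1}(\mu)}$ for $\mathbf{x}\in\mathbb{C}^{\Omega_d}$, $\mu\in\Omega_d$. Then the space $\mathbb{C}^{\Omega_d}$ is a semi-simple $\mathcal{W}$-module with representation $\vartheta$. Moreover, for all $\mathbf{X}\in\mathrm{Toep}_d$ and all $s\in\mathcal{W}$, $$s\star\mathbf{X}=\vartheta(s)\,\mathbf{X}\,\vartheta(s^{-1}).$$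
   Context: Let $\langle\cdot,\cdot\rangle$ be the inner product on $V$ with norm $\|u\|=\sqrt{\langle u,u\rangle}$. The dual lattice of $\Omega$ is $\Lambda=\{\lambda\in V \mid \langle\mu,\lambda\rangle\in\mathbb{Z}\ \text{for all}\ \mu\in\Omega\}$. The Voronoi cell of $\Lambda$ is $\mathrm{Vor}(\Lambda)=\{u\in V\mid \|u\|\le\|u-\lambda\|\ \text{for all}\ \lambda\in\Lambda\}$. For $d\in\mathbb{N}=\{0,1,2,\ldots\}$, $\Omega_d:=\Omega\cap d\,\mathrm{Vor}(\Lambda)$, which is a finite set. $\mathbb{C}^{\Omega_d}$ is the space of complex-valued vectors indexed by $\Omega_d$. $\mathrm{Toep}_d$ denotes the real vector space of Hermitian matrices $\mathbf{X}$ with complex entries $\mathbf{X}_{\mu\nu}$, rows and columns indexed by $\Omega_d$, that are Toeplitz, meaning that $\mathbf{X}_{\mu\nu}$ depends only on $\mu-\nu$. $\mathcal{W}$ acts on $\mathrm{Toep}_d$ by $(s\star\mathbf{X})_{\mu\nu}:=\mathbf{X}_{s^{-1}(\mu)\,s^{-1}(\nu)}$. *)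

theory Defs
  imports
    "HOL-Analysis.Inner_Product"
    "HOL-Library.Function_Algebras"
    "HOL-Algebra.Coset"
begin

definition full_lattice :: "'v::real_vector set \<Rightarrow> bool" where
  "full_lattice \<Omega> \<longleftrightarrow>
     (\<exists>B. finite B \<and> independent B \<and> span B = UNIV \<and>
          \<Omega> = range (\<lambda>c::'v \<Rightarrow> int. \<Sum>b\<in>B. of_int (c b) *\<^sub>R b))"

definition dual_lattice :: "'v::real_inner set \<Rightarrow> 'v set" where
  "dual_lattice \<Omega> = {l. \<forall>\<mu>\<in>\<Omega>. inner \<mu> l \<in> \<int>}"

definition voronoi :: "'v::real_inner set \<Rightarrow> 'v set" where
  "voronoi \<Lambda> = {u. \<forall>l\<in>\<Lambda>. norm u \<le> norm (u - l)}"

definition lattice_trunc :: "'v::real_inner set \<Rightarrow> nat \<Rightarrow> 'v set" where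
  "lattice_trunc \<Omega> d = \<Omega> \<inter> (\<lambda>u. real d *\<^sub>R u) ` voronoi (dual_lattice \<Omega>)"

text \<open>
  Vectors and matrices indexed by a set \<open>I\<close> of some type are functions on the whole type that
  vanish outside \<open>I\<close>. With the pointwise operations, the space of vectors indexed by \<open>I\<close> is then a
  complex subspace of the function space, and equality of functions is equality of all entries.
\<close>

global_interpretation cfun: vector_space "\<lambda>(c::complex) (x::'i \<Rightarrow> complex) i. c * x i"
  defines cfun_span = cfun.span
    and cfun_subspace = cfun.subspace
  by unfold_locales (auto simp: fun_eq_iff algebra_simps)

definition cvecs :: "'i set \<Rightarrow> ('i \<Rightarrow> complex) set" where
  "cvecs I = {x. \<forall>i. i \<notin> I \<longrightarrow> x i = 0}"

definition cmats :: "'i set \<Rightarrow> ('i \<Rightarrow> 'i \<Rightarrow> complex) set" where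
  "cmats I = {X. \<forall>i j. i \<notin> I \<or> j \<notin> I \<longrightarrow> X i j = 0}"

definition mat_vec :: "'i set \<Rightarrow> ('i \<Rightarrow> 'i \<Rightarrow> complex) \<Rightarrow> ('i \<Rightarrow> complex) \<Rightarrow> 'i \<Rightarrow> complex" where
  "mat_vec I A x = (\<lambda>i. \<Sum>j\<in>I. A i j * x j)"

definition mat_mult ::
  "'i set \<Rightarrow> ('i \<Rightarrow> 'i \<Rightarrow> complex) \<Rightarrow> ('i \<Rightarrow> 'i \<Rightarrow> complex) \<Rightarrow> 'i \<Rightarrow> 'i \<Rightarrow> complex" where
  "mat_mult I A B = (\<lambda>i j. \<Sum>k\<in>I. A i k * B k j)"

definition mat_one :: "'i set \<Rightarrow> 'i \<Rightarrow> 'i \<Rightarrow> complex" where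
  "mat_one I = (\<lambda>i j. if i \<in> I \<and> i = j then 1 else 0)"

definition mat_monoid :: "'i set \<Rightarrow> ('i \<Rightarrow> 'i \<Rightarrow> complex) monoid" where
  "mat_monoid I = \<lparr>carrier = cmats I, monoid.mult = mat_mult I, one = mat_one I\<rparr>"

text \<open>
  A representation of \<open>G\<close> on the vectors indexed by a finite set \<open>I\<close> is a homomorphism from \<open>G\<close> to
  the group of invertible matrices indexed by \<open>I\<close>; it turns that space into a \<open>G\<close>-module.
\<close>

definition representation ::
  "('g, 'm) monoid_scheme \<Rightarrow> 'i set \<Rightarrow> ('g \<Rightarrow> 'i \<Rightarrow> 'i \<Rightarrow> complex) \<Rightarrow> bool" where
  "representation G I \<rho> \<longleftrightarrow> finite I \<and> group_hom G (units_of (mat_monoid I)) \<rho>"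

definition submodule ::
  "('g, 'm) monoid_scheme \<Rightarrow> 'i set \<Rightarrow> ('g \<Rightarrow> 'i \<Rightarrow> 'i \<Rightarrow> complex) \<Rightarrow> ('i \<Rightarrow> complex) set \<Rightarrow> bool"
where
  "submodule G I \<rho> U \<longleftrightarrow>
     cfun_subspace U \<and> U \<subseteq> cvecs I \<and> (\<forall>g\<in>carrier G. \<forall>x\<in>U. mat_vec I (\<rho> g) x \<in> U)"

definition simple_submodule ::
  "('g, 'm) monoid_scheme \<Rightarrow> 'i set \<Rightarrow> ('g \<Rightarrow> 'i \<Rightarrow> 'i \<Rightarrow> complex) \<Rightarrow> ('i \<Rightarrow> complex) set \<Rightarrow> bool"
where
  "simple_submodule G I \<rho> U \<longleftrightarrow>
     submodule G I \<rho> U \<and> U \<noteq> {0} \<and>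
     (\<forall>U'. submodule G I \<rho> U' \<and> U' \<subseteq> U \<longrightarrow> U' = {0} \<or> U' = U)"

definition internal_direct_sum ::
  "('i \<Rightarrow> complex) set set \<Rightarrow> ('i \<Rightarrow> complex) set \<Rightarrow> bool" where
  "internal_direct_sum \<S> M \<longleftrightarrow>
     cfun_span (\<Union>\<S>) = M \<and> (\<forall>U\<in>\<S>. U \<inter> cfun_span (\<Union>(\<S> - {U})) = {0})"

definition semisimple_module ::
  "('g, 'm) monoid_scheme \<Rightarrow> 'i set \<Rightarrow> ('g \<Rightarrow> 'i \<Rightarrow> 'i \<Rightarrow> complex) \<Rightarrow> bool" where
  "semisimple_module G I \<rho> \<longleftrightarrow>
     representation G I \<rho> \<and>
     (\<exists>\<S>. (\<forall>U\<in>\<S>. simple_submodule G I \<rho> U) \<and> internal_direct_sum \<S> (cvecs I))"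

definition GL :: "('v::real_vector \<Rightarrow> 'v) monoid" where
  "GL = \<lparr>carrier = {s. linear s \<and> bij s}, monoid.mult = (\<circ>), one = id\<rparr>"

definition perm_matrix :: "'v::real_vector set \<Rightarrow> ('v \<Rightarrow> 'v) \<Rightarrow> 'v \<Rightarrow> 'v \<Rightarrow> complex" where
  "perm_matrix I s = (\<lambda>\<mu> \<nu>. if \<mu> \<in> I \<and> \<nu> \<in> I \<and> (inv\<^bsub>GL\<^esub> s) \<mu> = \<nu> then 1 else 0)"

definition Toep :: "'v::real_inner set \<Rightarrow> nat \<Rightarrow> ('v \<Rightarrow> 'v \<Rightarrow> complex) set" where
  "Toep \<Omega> d = {X \<in> cmats (lattice_trunc \<Omega> d).
     (\<forall>\<mu>\<in>lattice_trunc \<Omega> d. \<forall>\<nu>\<in>lattice_trunc \<Omega> d. X \<nu> \<mu> = cnj (X \<mu> \<nu>)) \<and>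
     (\<forall>\<mu>\<in>lattice_trunc \<Omega> d. \<forall>\<nu>\<in>lattice_trunc \<Omega> d.
      \<forall>\<mu>'\<in>lattice_trunc \<Omega> d. \<forall>\<nu>'\<in>lattice_trunc \<Omega> d.
        \<mu> - \<nu> = \<mu>' - \<nu>' \<longrightarrow> X \<mu> \<nu> = X \<mu>' \<nu>')}"

definition toep_act ::
  "('v::real_vector \<Rightarrow> 'v) \<Rightarrow> ('v \<Rightarrow> 'v \<Rightarrow> complex) \<Rightarrow> 'v \<Rightarrow> 'v \<Rightarrow> complex" (infixr "\<star>" 75) where
  "s \<star> X = (\<lambda>\<mu> \<nu>. X ((inv\<^bsub>GL\<^esub> s) \<mu>) ((inv\<^bsub>GL\<^esub> s) \<nu>))"

lemma linear_inv_into_UNIV: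
  assumes "linear s" "bij s"
  shows "linear (inv_into UNIV s)"
proof (rule linearI)
  have r: "s (inv_into UNIV s y) = y" for y
    using assms(2) by (simp add: bij_is_surj surj_f_inv_f)
  have l: "inv_into UNIV s (s y) = y" for y
    using assms(2) by (simp add: bij_is_inj)
  fix x y and c :: real
  have "s (inv_into UNIV s x + inv_into UNIV s y) = x + y"
    by (simp only: linear_add[OF assms(1)] r)
  then show "inv_into UNIV s (x + y) = inv_into UNIV s x + inv_into UNIV s y"
    using l[of "inv_into UNIV s x + inv_into UNIV s y"] by simp
  have "s (c *\<^sub>R inv_into UNIV s x) = c *\<^sub>R x"
    by (simp only: linear_cmul[OF assms(1)] r)
  then show "inv_into UNIV s (c *\<^sub>R x) = c *\<^sub>R inv_into UNIV s x"
    using l[of "c *\<^sub>R inv_into UNIV s x"] by simp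
qed

lemma inv_into_GL:
  assumes "s \<in> carrier GL"
  shows "inv_into UNIV s \<in> carrier GL" "inv_into UNIV s \<otimes>\<^bsub>GL\<^esub> s = \<one>\<^bsub>GL\<^esub>"
  using assms by (simp_all add: GL_def linear_inv_into_UNIV bij_imp_bij_inv bij_is_inj)

lemma group_GL: "group (GL :: ('v::real_vector \<Rightarrow> 'v) monoid)"
proof (rule groupI)
  fix s t :: "'v \<Rightarrow> 'v" assume "s \<in> carrier GL" "t \<in> carrier GL"
  then show "s \<otimes>\<^bsub>GL\<^esub> t \<in> carrier GL"
    unfolding GL_def by (simp add: linear_compose bij_comp)
next
  show "\<one>\<^bsub>GL\<^esub> \<in> carrier (GL :: ('v \<Rightarrow> 'v) monoid)"
    by (simp add: GL_def linear_iff)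
next
  fix s :: "'v \<Rightarrow> 'v" assume "s \<in> carrier GL"
  then show "\<exists>t\<in>carrier GL. t \<otimes>\<^bsub>GL\<^esub> s = \<one>\<^bsub>GL\<^esub>"
    using inv_into_GL by (intro bexI)
qed (simp_all add: GL_def comp_def)

lemma inv_GL:
  assumes "s \<in> carrier GL"
  shows "inv\<^bsub>GL\<^esub> s = inv_into UNIV s"
  using group.inv_equality[OF group_GL inv_into_GL(2)[OF assms] assms inv_into_GL(1)[OF assms]] .

lemma mat_vec_perm_matrix:
  assumes "finite I" "s \<in> carrier GL" "s ` I = I" "\<mu> \<in> I"
  shows "mat_vec I (perm_matrix I s) x \<mu> = x ((inv\<^bsub>GL\<^esub> s) \<mu>)"
proof -
  obtain \<nu> where \<nu>: "\<nu> \<in> I" "\<mu> = s \<nu>" using assms(3,4) by blast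
  have "inj s" using assms(2) by (simp add: GL_def bij_is_inj)
  then have inv: "(inv\<^bsub>GL\<^esub> s) \<mu> = \<nu>"
    by (simp only: inv_GL[OF assms(2)] \<nu>(2) inv_f_f)
  have "mat_vec I (perm_matrix I s) x \<mu> = (\<Sum>j\<in>I. if \<nu> = j then x j else 0)"
    unfolding mat_vec_def by (intro sum.cong refl) (simp add: perm_matrix_def inv assms(4))
  also have "\<dots> = x \<nu>" using assms(1) \<nu>(1) by simp
  finally show ?thesis by (simp only: inv)
qed

end

theory Submission
  imports Defs
begin

text \<open>
  Three facts carry the theorem.

  The index set \<open>\<Omega>\<^sub>d\<close> is finite (\<open>finite_lattice_trunc\<close>). A basis \<open>B\<close> of the lattice \<open>\<Omega>\<close> has a
  dual basis, which consists of elements of the dual lattice \<open>\<Lambda>\<close>. If \<open>u\<close> lies in the Voronoi cell,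
  then comparing \<open>u\<close> with \<open>u - \<lambda>\<close> and \<open>u + \<lambda>\<close> gives \<open>2 * \<bar>\<langle>u, \<lambda>\<rangle>\<bar> \<le> \<parallel>\<lambda>\<parallel>\<^sup>2\<close> for every \<open>\<lambda> \<in> \<Lambda>\<close>. For \<open>\<lambda>\<close> in the
  dual basis this bounds each of the integer coordinates of a vector in \<open>\<Omega>\<^sub>d\<close>.

  A unitary representation on the vectors indexed by a finite set is semi-simple
  (\<open>unitary_representation_semisimple\<close>). The orthogonal complement of a submodule is a submodule, so
  a nonzero submodule splits off a submodule of minimal positive dimension, which is simple, and
  the complement is treated by induction on the dimension. Permutation matrices are unitary, so no
  averaging over the group is needed.

  Finally, multiplication by \<open>\<vartheta>(s)\<close> on the left replaces a row index \<open>\<mu>\<close> by \<open>s\<^sup>-\<^sup>1(\<mu>)\<close>, and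
  multiplication by \<open>\<vartheta>(s\<^sup>-\<^sup>1)\<close> on the right does the same to the column index. The first of these
  gives the homomorphism property of \<open>\<vartheta>\<close>, and the two together give the formula for the action on
  matrices (\<open>toep_act_eq_conjugation\<close>), which holds for every matrix indexed by \<open>\<Omega>\<^sub>d\<close>.
\<close>

section \<open>Orthogonal projection and dimension\<close>

text \<open>
  The form \<open>f\<close> need only be linear in its first argument: symmetry of orthogonality makes up for
  the second one. The lemma thus applies to real inner products and to Hermitian forms alike.
  Anisotropy is required on the subspace only, because the standard Hermitian form of vectors
  indexed by \<open>I\<close> degenerates on functions that do not vanish outside \<open>I\<close>.
\<close>

lemma (in vector_space) orthogonal_projection_exists:
  fixes f :: "'b \<Rightarrow> 'b \<Rightarrow> 'a"
  assumes "finite S"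
    and add: "\<And>x y z. f (x + y) z = f x z + f y z"
    and scl: "\<And>c x z. f (c *s x) z = c * f x z"
    and sym: "\<And>x y. f x y = 0 \<Longrightarrow> f y x = 0"
    and aniso: "\<And>x. x \<in> span S \<Longrightarrow> f x x = 0 \<Longrightarrow> x = 0"
  shows "\<exists>p\<in>span S. \<forall>s\<in>span S. f (x - p) s = 0"
  using assms(1) aniso
proof (induction S arbitrary: x rule: finite_induct)
  case empty
  have "f 0 x = 0" for x
    using scl[of 0 0 x] by simp
  then show ?case
    using sym by auto
next
  case (insert a S)
  have sub: "subspace {s. f x s = 0}" for x
  proof -
    have "f 0 x = 0" using scl[of 0 0 x] by simp
    then have "subspace {s. f s x = 0}"
      by (simp add: subspace_def add scl)
    moreover have "{s. f x s = 0} = {s. f s x = 0}"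
      using sym by blast
    ultimately show ?thesis by simp
  qed
  have SS: "span S \<subseteq> span (insert a S)"
    by (rule span_mono) auto
  then have IH: "\<exists>p\<in>span S. \<forall>s\<in>span S. f (x - p) s = 0" for x
    using insert.IH insert.prems by blast
  obtain q where q: "q \<in> span S" "\<And>s. s \<in> span S \<Longrightarrow> f (a - q) s = 0"
    using IH by blast
  obtain p where p: "p \<in> span S" "\<And>s. s \<in> span S \<Longrightarrow> f (x - p) s = 0"
    using IH by blast
  define r where "r = a - q"
  have rin: "r \<in> span (insert a S)"
    unfolding r_def using q(1) SS by (auto intro: span_diff span_base)
  \<comment> \<open>If \<open>r = 0\<close> then the divisor below is zero and \<open>c = 0\<close>, which is still the right coefficient.\<close>
  define c where "c = f (x - p) r / f r r"
  have diff: "f (y - z) w = f y w - f z w" for y z w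
    using add[of "y - z" z w] by simp
  have S0: "f (x - (p + c *s r)) s = 0" if "s \<in> span S" for s
    using p(2)[OF that] q(2)[OF that] add[of p "c *s r" s]
    by (simp add: diff scl add r_def)
  have r0: "f (x - (p + c *s r)) r = 0"
  proof (cases "r = 0")
    case True
    then show ?thesis using S0 span_zero by simp
  next
    case False
    then have "f r r \<noteq> 0" using insert.prems rin by blast
    then have "f (x - p) r - c * f r r = 0" by (simp add: c_def)
    then show ?thesis by (simp only: diff add scl diff_diff_eq)
  qed
  have a0: "f (x - (p + c *s r)) a = 0"
    using subspace_add[OF sub[of "x - (p + c *s r)"], of r q] S0[OF q(1)] r0
    by (simp add: r_def)
  have "insert a S \<subseteq> {s. f (x - (p + c *s r)) s = 0}"
    using a0 S0 span_base by blast
  then have "span (insert a S) \<subseteq> {s. f (x - (p + c *s r)) s = 0}"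
    by (rule span_minimal[OF _ sub])
  moreover have "p + c *s r \<in> span (insert a S)"
    using p(1) SS rin by (auto intro: span_add span_scale)
  ultimately show ?case by blast
qed

lemma (in vector_space) dim_less_of_psubspace:
  assumes "subspace U" "U \<subset> T" "T \<subseteq> span F" "finite F"
  shows "dim U < dim T"
proof -
  obtain A where A: "A \<subseteq> U" "independent A" "U \<subseteq> span A" "card A = dim U"
    using basis_exists by blast
  have spA: "span A = U"
    using A assms(1) span_minimal by blast
  obtain x where x: "x \<in> T" "x \<notin> U" using assms(2) by blast
  have ind: "independent (insert x A)"
    using A(2) x(2) spA by (simp add: independent_insertI)
  have "insert x A \<subseteq> T" using x A(1) assms(2) by blast
  then obtain B where B: "insert x A \<subseteq> B" "B \<subseteq> T" "independent B" "T \<subseteq> span B"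
    using maximal_independent_subset_extend ind by metis
  have "finite B"
    using independent_span_bound[OF assms(4) B(3)] B(2) assms(3) by blast
  moreover have "x \<notin> A" using x A(1) by blast
  ultimately have "card A < card B"
    using B(1) by (intro psubset_card_mono) auto
  then show ?thesis
    using A(4) basis_card_eq_dim[OF B(2,4,3)] by simp
qed

section \<open>Finiteness of the truncated lattice\<close>

lemma dual_vector_exists:
  fixes B :: "'v::real_inner set"
  assumes "finite B" "independent B" "b \<in> B"
  shows "\<exists>l. inner b l = 1 \<and> (\<forall>b'\<in>B - {b}. inner b' l = 0)"
proof -
  \<comment> \<open>The vector sought is the component of \<open>b\<close> orthogonal to the other basis vectors, rescaled.\<close>
  have "\<exists>p\<in>span (B - {b}). \<forall>s\<in>span (B - {b}). inner (b - p) s = 0"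
  proof (rule real_vector.orthogonal_projection_exists[where f = inner])
    show "inner y x = 0" if "inner x y = 0" for x y :: 'v
      using that by (metis inner_commute)
  qed (use assms(1) in \<open>simp_all add: inner_add_left\<close>)
  then obtain p where p: "p \<in> span (B - {b})" "\<And>s. s \<in> span (B - {b}) \<Longrightarrow> inner (b - p) s = 0"
    by blast
  have "b \<notin> span (B - {b})"
    using assms(2,3) unfolding dependent_def by blast
  then have "b - p \<noteq> 0" using p(1) by auto
  moreover have "inner b (b - p) = inner (b - p) (b - p)"
    using p(2)[OF p(1)] by (metis diff_zero inner_commute inner_diff_right)
  ultimately have nz: "inner b (b - p) \<noteq> 0" by simp
  show ?thesis
  proof (intro exI conjI ballI)
    show "inner b ((1 / inner b (b - p)) *\<^sub>R (b - p)) = 1"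
      using nz by simp
    fix b' assume "b' \<in> B - {b}"
    then have "inner (b - p) b' = 0" by (intro p(2) span_base)
    then have "inner b' (b - p) = 0" by (metis inner_commute)
    then show "inner b' ((1 / inner b (b - p)) *\<^sub>R (b - p)) = 0"
      by simp
  qed
qed

lemma voronoi_inner_bound:
  assumes "u \<in> voronoi \<Lambda>" "l \<in> \<Lambda>" "- l \<in> \<Lambda>"
  shows "2 * \<bar>inner u l\<bar> \<le> inner l l"
proof -
  have *: "2 * inner u m \<le> inner m m" if "m \<in> \<Lambda>" for m
  proof -
    have "norm u \<le> norm (u - m)"
      using assms(1) that by (auto simp: voronoi_def)
    then have "inner u u \<le> inner (u - m) (u - m)"
      by (simp add: norm_le)
    then show ?thesis
      by (simp add: inner_diff_left inner_diff_right inner_commute)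
  qed
  show ?thesis
    using *[OF assms(2)] *[OF assms(3)] by simp
qed

lemma finite_lattice_trunc:
  fixes \<Omega> :: "'v::real_inner set"
  assumes "full_lattice \<Omega>"
  shows "finite (lattice_trunc \<Omega> d)"
proof -
  obtain B where B: "finite B" "independent B"
    and \<Omega>: "\<Omega> = range (\<lambda>c::'v \<Rightarrow> int. \<Sum>b\<in>B. of_int (c b) *\<^sub>R b)"
    using assms by (auto simp: full_lattice_def)
  obtain l where l: "\<And>b. b \<in> B \<Longrightarrow> inner b (l b) = 1"
    "\<And>b b'. b \<in> B \<Longrightarrow> b' \<in> B - {b} \<Longrightarrow> inner b' (l b) = 0"
    using dual_vector_exists[OF B] by metis
  have coord: "inner (\<Sum>b'\<in>B. of_int (c b') *\<^sub>R b') (l b) = of_int (c b)"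
    if "b \<in> B" for c :: "'v \<Rightarrow> int" and b
  proof -
    have "inner (\<Sum>b'\<in>B. of_int (c b') *\<^sub>R b') (l b) =
        (\<Sum>b'\<in>B. of_int (c b') * inner b' (l b))"
      by (simp add: inner_sum_left)
    also have "\<dots> = (\<Sum>b'\<in>B. if b' = b then of_int (c b) else 0)"
      using l that by (intro sum.cong) auto
    finally show ?thesis using B(1) that by simp
  qed
  have dual: "l b \<in> dual_lattice \<Omega>" "- l b \<in> dual_lattice \<Omega>" if "b \<in> B" for b
    using coord[OF that] by (auto simp: dual_lattice_def \<Omega>)
  \<comment> \<open>The factor one half of the Voronoi bound is not needed for finiteness.\<close>
  define N where "N b = \<lceil>real d * inner (l b) (l b)\<rceil>" for b
  define C where "C = B \<rightarrow>\<^sub>E (\<Union>b\<in>B. {- N b..N b})"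
  have "lattice_trunc \<Omega> d \<subseteq> (\<lambda>c. \<Sum>b\<in>B. of_int (c b) *\<^sub>R b) ` C"
  proof
    fix \<mu> assume "\<mu> \<in> lattice_trunc \<Omega> d"
    then have "\<mu> \<in> \<Omega>" and "\<exists>u\<in>voronoi (dual_lattice \<Omega>). \<mu> = real d *\<^sub>R u"
      by (auto simp: lattice_trunc_def)
    then obtain u where u: "\<mu> = real d *\<^sub>R u" "u \<in> voronoi (dual_lattice \<Omega>)"
      by blast
    obtain c :: "'v \<Rightarrow> int" where c: "\<mu> = (\<Sum>b\<in>B. of_int (c b) *\<^sub>R b)"
      using \<open>\<mu> \<in> \<Omega>\<close> unfolding \<Omega> by blast
    have bound: "c b \<in> {- N b..N b}" if "b \<in> B" for b
    proof -
      have "real_of_int (c b) = real d * inner u (l b)"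
        using coord[OF that, of c] unfolding c[symmetric] u(1) by simp
      then have "\<bar>real_of_int (c b)\<bar> = real d * \<bar>inner u (l b)\<bar>"
        by (simp add: abs_mult)
      also have "\<dots> \<le> real d * inner (l b) (l b)"
        using voronoi_inner_bound[OF u(2) dual[OF that]] by (intro mult_left_mono) auto
      finally have "\<bar>c b\<bar> \<le> N b"
        unfolding N_def by linarith
      then show ?thesis by auto
    qed
    have "\<mu> = (\<Sum>b\<in>B. of_int (restrict c B b) *\<^sub>R b)"
      unfolding c by (intro sum.cong) auto
    moreover have "restrict c B \<in> C"
      unfolding C_def using bound by (intro restrict_PiE_iff[THEN iffD2]) blast
    ultimately show "\<mu> \<in> (\<lambda>c. \<Sum>b\<in>B. of_int (c b) *\<^sub>R b) ` C"
      by blast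
  qed
  moreover have "finite C"
    unfolding C_def using B(1) by (intro finite_PiE) auto
  ultimately show ?thesis
    by (meson finite_imageI finite_subset)
qed

section \<open>Matrices indexed by a finite set\<close>

lemma mat_mult_assoc:
  "mat_mult I (mat_mult I A B) C = mat_mult I A (mat_mult I B C)"
proof (intro ext)
  fix i j
  have "mat_mult I (mat_mult I A B) C i j = (\<Sum>k\<in>I. \<Sum>m\<in>I. A i m * B m k * C k j)"
    by (simp add: mat_mult_def sum_distrib_right)
  also have "\<dots> = (\<Sum>m\<in>I. \<Sum>k\<in>I. A i m * B m k * C k j)"
    by (rule sum.swap)
  finally show "mat_mult I (mat_mult I A B) C i j = mat_mult I A (mat_mult I B C) i j"
    by (simp add: mat_mult_def sum_distrib_left mult.assoc)
qed

lemma mat_mult_in_cmats: "A \<in> cmats I \<Longrightarrow> B \<in> cmats I \<Longrightarrow> mat_mult I A B \<in> cmats I"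
  by (auto simp: cmats_def mat_mult_def)

lemma mat_one_in_cmats: "mat_one I \<in> cmats I"
  by (auto simp: cmats_def mat_one_def)

lemma monoid_mat_monoid:
  assumes "finite I"
  shows "monoid (mat_monoid I)"
proof (rule monoidI)
  fix A :: "'a \<Rightarrow> 'a \<Rightarrow> complex" assume A: "A \<in> carrier (mat_monoid I)"
  have 1: "(\<Sum>k\<in>I. mat_one I i k * A k j) = (\<Sum>k\<in>I. if i = k then A k j else 0)" for i j
    by (intro sum.cong) (auto simp: mat_one_def)
  have 2: "(\<Sum>k\<in>I. A i k * mat_one I k j) = (\<Sum>k\<in>I. if k = j then A i k else 0)" for i j
    by (intro sum.cong) (auto simp: mat_one_def)
  show "\<one>\<^bsub>mat_monoid I\<^esub> \<otimes>\<^bsub>mat_monoid I\<^esub> A = A"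
    using A assms by (auto simp: mat_monoid_def mat_mult_def cmats_def 1 intro!: ext)
  show "A \<otimes>\<^bsub>mat_monoid I\<^esub> \<one>\<^bsub>mat_monoid I\<^esub> = A"
    using A assms by (auto simp: mat_monoid_def mat_mult_def cmats_def 2 intro!: ext)
qed (simp_all add: mat_monoid_def mat_mult_assoc mat_mult_in_cmats mat_one_in_cmats)

lemma mat_vec_mat_mult:
  "mat_vec I (mat_mult I A B) x = mat_vec I A (mat_vec I B x)"
proof
  fix i
  have "mat_vec I (mat_mult I A B) x i = (\<Sum>k\<in>I. \<Sum>m\<in>I. A i m * B m k * x k)"
    by (simp add: mat_vec_def mat_mult_def sum_distrib_right)
  also have "\<dots> = (\<Sum>m\<in>I. \<Sum>k\<in>I. A i m * B m k * x k)"
    by (rule sum.swap)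
  finally show "mat_vec I (mat_mult I A B) x i = mat_vec I A (mat_vec I B x) i"
    by (simp add: mat_vec_def sum_distrib_left mult.assoc)
qed

lemma mat_vec_mat_one:
  assumes "finite I" "x \<in> cvecs I"
  shows "mat_vec I (mat_one I) x = x"
proof
  fix i
  have "mat_vec I (mat_one I) x i = (\<Sum>k\<in>I. if i = k then x k else 0)"
    unfolding mat_vec_def by (intro sum.cong) (auto simp: mat_one_def)
  then show "mat_vec I (mat_one I) x i = x i"
    using assms by (auto simp: cvecs_def)
qed

lemma mat_vec_add: "mat_vec I A (x + y) = mat_vec I A x + mat_vec I A y"
  by (auto simp: mat_vec_def algebra_simps sum.distrib)

lemma mat_vec_scale: "mat_vec I A (\<lambda>i. c * x i) = (\<lambda>i. c * mat_vec I A x i)"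
  by (auto simp: mat_vec_def sum_distrib_left algebra_simps)

lemma subspace_cvecs: "cfun_subspace (cvecs I)"
  by (auto simp: cfun.subspace_def cvecs_def)

lemma cvecs_finite_spanning:
  fixes I :: "'i set"
  assumes "finite I"
  obtains F where "finite F" "cvecs I \<subseteq> cfun_span F"
proof
  define e where "e = (\<lambda>i j::'i. if j = i then 1 else 0 :: complex)"
  show "finite (e ` I)" using assms by simp
  show "cvecs I \<subseteq> cfun_span (e ` I)"
  proof
    fix x :: "'i \<Rightarrow> complex" assume x: "x \<in> cvecs I"
    have sum_app: "(\<Sum>i\<in>J. g i) j = (\<Sum>i\<in>J. g i j)"
      for J :: "'i set" and g :: "'i \<Rightarrow> 'i \<Rightarrow> complex" and j
      by (induction J rule: infinite_finite_induct) auto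
    have coord: "x j = (\<Sum>i\<in>I. x i * e i j)" for j
    proof -
      have "(\<Sum>i\<in>I. x i * e i j) = (\<Sum>i\<in>I. if i = j then x i else 0)"
        by (intro sum.cong) (auto simp: e_def)
      then show ?thesis using x assms by (auto simp: cvecs_def)
    qed
    have "x = (\<Sum>i\<in>I. (\<lambda>j. x i * e i j))"
      by (intro ext, subst sum_app) (rule coord)
    also have "\<dots> \<in> cfun_span (e ` I)"
    proof (rule cfun.span_sum)
      fix i assume "i \<in> I"
      then have "e i \<in> cfun_span (e ` I)"
        by (simp add: cfun.span_base)
      then show "(\<lambda>j. x i * e i j) \<in> cfun_span (e ` I)"
        by (rule cfun.span_scale)
    qed
    finally show "x \<in> cfun_span (e ` I)" .
  qed
qed

section \<open>Semi-simplicity of unitary representations\<close>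

text \<open>The standard Hermitian form of vectors indexed by \<open>I\<close>, linear in its first argument.\<close>

definition cinner :: "'i set \<Rightarrow> ('i \<Rightarrow> complex) \<Rightarrow> ('i \<Rightarrow> complex) \<Rightarrow> complex" where
  "cinner I x y = (\<Sum>i\<in>I. x i * cnj (y i))"

lemma cinner_add_left: "cinner I (x + y) z = cinner I x z + cinner I y z"
  by (simp add: cinner_def algebra_simps sum.distrib)

lemma cinner_scale_left: "cinner I (\<lambda>i. c * x i) z = c * cinner I x z"
  by (simp add: cinner_def sum_distrib_left algebra_simps)

lemma cinner_commute: "cinner I y x = cnj (cinner I x y)"
  by (simp add: cinner_def mult.commute)

lemma cinner_self_eq_0:
  assumes "finite I" "x \<in> cvecs I" "cinner I x x = 0"
  shows "x = 0"
proof
  fix i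
  have "complex_of_real (\<Sum>i\<in>I. (cmod (x i))\<^sup>2) = 0"
    using assms(3) by (simp add: cinner_def complex_norm_square[symmetric])
  then have "(\<Sum>i\<in>I. (cmod (x i))\<^sup>2) = 0"
    using of_real_eq_0_iff by blast
  then have "\<forall>i\<in>I. (cmod (x i))\<^sup>2 = 0"
    using assms(1) by (simp add: sum_nonneg_eq_0_iff)
  then show "x i = 0 i"
    using assms(2) by (auto simp: cvecs_def)
qed

lemma cvecs_orthogonal_projection:
  assumes "finite I" "cfun_subspace U" "U \<subseteq> cvecs I"
  shows "\<exists>p\<in>U. \<forall>y\<in>U. cinner I (x - p) y = 0"
proof -
  obtain A where A: "A \<subseteq> U" "cfun.independent A" "U \<subseteq> cfun_span A"
    using cfun.maximal_independent_subset by blast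
  have sp: "cfun_span A = U"
    using A assms(2) cfun.span_minimal by blast
  obtain F where F: "finite F" "cvecs I \<subseteq> cfun_span F"
    using cvecs_finite_spanning[OF assms(1)] .
  have "finite A"
    using cfun.independent_span_bound[OF F(1) A(2)] A(1) assms(3) F(2) by blast
  then have "\<exists>p\<in>cfun_span A. \<forall>y\<in>cfun_span A. cinner I (x - p) y = 0"
  proof (rule cfun.orthogonal_projection_exists[where f = "cinner I"])
    show "cinner I y x = 0" if "cinner I x y = 0" for x y
      using that cinner_commute[of I y x] by simp
    show "x = 0" if "x \<in> cfun_span A" "cinner I x x = 0" for x
      using cinner_self_eq_0[OF assms(1)] that sp assms(3) by blast
  qed (simp_all add: cinner_add_left cinner_scale_left)
  then show ?thesis by (simp add: sp)
qed

lemma submodule_orthogonal_complement: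
  assumes rep: "representation G I \<rho>"
    and unitary: "\<And>g x y. g \<in> carrier G \<Longrightarrow> x \<in> cvecs I \<Longrightarrow> y \<in> cvecs I \<Longrightarrow>
      cinner I (mat_vec I (\<rho> g) x) (mat_vec I (\<rho> g) y) = cinner I x y"
    and U: "submodule G I \<rho> U" and U1: "submodule G I \<rho> U1"
  shows "submodule G I \<rho> {x \<in> U. \<forall>y\<in>U1. cinner I x y = 0}"
proof -
  have fin: "finite I" and "group_hom G (units_of (mat_monoid I)) \<rho>"
    using rep by (auto simp: representation_def)
  then interpret group_hom G "units_of (mat_monoid I)" \<rho> by simp
  have subU: "cfun_subspace U" and UI: "U \<subseteq> cvecs I" and U1I: "U1 \<subseteq> cvecs I"
    using U U1 by (auto simp: submodule_def)
  have cancel: "mat_vec I (\<rho> g) (mat_vec I (\<rho> (inv\<^bsub>G\<^esub> g)) y) = y"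
    if g: "g \<in> carrier G" and y: "y \<in> cvecs I" for g y
  proof -
    have "mat_mult I (\<rho> g) (\<rho> (inv\<^bsub>G\<^esub> g)) = \<rho> (g \<otimes>\<^bsub>G\<^esub> inv\<^bsub>G\<^esub> g)"
      using hom_mult[OF g G.inv_closed[OF g]]
        by (simp only: units_of_mult) (simp add: mat_monoid_def)
    also have "\<dots> = mat_one I"
      using hom_one by (simp only: G.r_inv[OF g] units_of_one) (simp add: mat_monoid_def)
    finally show ?thesis
      using mat_vec_mat_one[OF fin y] by (simp add: mat_vec_mat_mult[symmetric])
  qed
  have zero: "cinner I 0 y = 0" for y by (simp add: cinner_def)
  have "cfun_subspace {x \<in> U. \<forall>y\<in>U1. cinner I x y = 0}"
    using subU by (auto simp: cfun.subspace_def cinner_add_left cinner_scale_left zero)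
  moreover have "mat_vec I (\<rho> g) x \<in> {x \<in> U. \<forall>y\<in>U1. cinner I x y = 0}"
    if g: "g \<in> carrier G" and x: "x \<in> {x \<in> U. \<forall>y\<in>U1. cinner I x y = 0}" for g x
  proof -
    have "cinner I (mat_vec I (\<rho> g) x) y = 0" if y: "y \<in> U1" for y
    proof -
      \<comment> \<open>Unitarity moves \<open>g\<close> from \<open>x\<close> to \<open>y\<close>, where it acts as its inverse and stays within \<open>U1\<close>.\<close>
      let ?y' = "mat_vec I (\<rho> (inv\<^bsub>G\<^esub> g)) y"
      have y': "?y' \<in> U1" using U1 y G.inv_closed[OF g] unfolding submodule_def by blast
      have "cinner I (mat_vec I (\<rho> g) x) y =
          cinner I (mat_vec I (\<rho> g) x) (mat_vec I (\<rho> g) ?y')"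
        using cancel[OF g] y U1I by auto
      also have "\<dots> = cinner I x ?y'"
        using unitary[OF g] x y' UI U1I by blast
      finally show ?thesis using x y' by simp
    qed
    then show ?thesis
      using U g x by (simp add: submodule_def)
  qed
  ultimately show ?thesis
    using UI by (auto simp: submodule_def)
qed

lemma nonzero_submodule_contains_simple:
  assumes "finite I" "submodule G I \<rho> U" "U \<noteq> {0}"
  obtains U1 where "simple_submodule G I \<rho> U1" "U1 \<subseteq> U"
proof -
  obtain F where F: "finite F" "cvecs I \<subseteq> cfun_span F"
    using cvecs_finite_spanning[OF assms(1)] .
  obtain U1 where U1: "submodule G I \<rho> U1 \<and> U1 \<noteq> {0} \<and> U1 \<subseteq> U"
    and min: "\<And>T. submodule G I \<rho> T \<and> T \<noteq> {0} \<and> T \<subseteq> U \<Longrightarrow> cfun.dim U1 \<le> cfun.dim T"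
    using ex_has_least_nat[of "\<lambda>T. submodule G I \<rho> T \<and> T \<noteq> {0} \<and> T \<subseteq> U" U cfun.dim] assms
    by auto
  have "T = {0} \<or> T = U1" if T: "submodule G I \<rho> T" "T \<subseteq> U1" for T
  proof (rule ccontr)
    assume "\<not> (T = {0} \<or> T = U1)"
    then have "T \<subset> U1" "T \<noteq> {0}"
      using T(2) by auto
    moreover have "cfun_subspace T" "U1 \<subseteq> cfun_span F"
      using T U1 F(2) by (auto simp: submodule_def)
    ultimately have "cfun.dim T < cfun.dim U1"
      using cfun.dim_less_of_psubspace F(1) by blast
    moreover have "cfun.dim U1 \<le> cfun.dim T"
      using min[of T] T U1 \<open>T \<noteq> {0}\<close> by blast
    ultimately show False by simp
  qed
  then have "simple_submodule G I \<rho> U1"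
    using U1 by (simp add: simple_submodule_def)
  then show ?thesis using that U1 by blast
qed

text \<open>
  A family of subspaces is a set here, so \<open>U\<close> must not already belong to \<open>\<S>\<close>; this follows from
  \<open>U \<noteq> {0}\<close>, because members of \<open>\<S>\<close> lie in \<open>M\<close>.
\<close>

lemma internal_direct_sum_insert:
  assumes "internal_direct_sum \<S> M" "cfun_subspace U" "cfun_subspace M"
    and disj: "U \<inter> M = {0}" and "U \<noteq> {0}"
  shows "internal_direct_sum (insert U \<S>) {x + y |x y. x \<in> U \<and> y \<in> M}"
proof -
  have sp: "cfun_span (\<Union>\<S>) = M"
    and ds: "\<And>X. X \<in> \<S> \<Longrightarrow> X \<inter> cfun_span (\<Union>(\<S> - {X})) = {0}"
    using assms(1) by (auto simp: internal_direct_sum_def)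
  have SM: "X \<subseteq> M" if "X \<in> \<S>" for X
    using sp that cfun.span_superset[of "\<Union>\<S>"] by blast
  have UnS: "U \<notin> \<S>" using SM disj assms(5) by blast
  have spU: "cfun_span U = U"
    using assms(2) cfun.span_eq_iff by blast
  have span_ins: "cfun_span (U \<union> \<Union>\<T>) = {x + y |x y. x \<in> U \<and> y \<in> cfun_span (\<Union>\<T>)}" for \<T>
    by (simp add: cfun.span_Un spU)
  have "X \<inter> cfun_span (\<Union>(insert U \<S> - {X})) = {0}" if X: "X \<in> insert U \<S>" for X
  proof (cases "X = U")
    case True
    then have "insert U \<S> - {X} = \<S>" using UnS by blast
    then show ?thesis using True sp disj by simp
  next
    case False
    then have XS: "X \<in> \<S>" using X by blast
    have eq: "insert U \<S> - {X} = insert U (\<S> - {X})" using False by blast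
    have sub: "cfun_span (\<Union>(\<S> - {X})) \<subseteq> M"
      unfolding sp[symmetric] by (rule cfun.span_mono) auto
    have "z = 0" if z: "z \<in> X" "z \<in> cfun_span (\<Union>(insert U \<S> - {X}))" for z
    proof -
      have "z \<in> cfun_span (U \<union> \<Union>(\<S> - {X}))" using z(2) eq by simp
      then obtain u v where uv: "z = u + v" "u \<in> U" "v \<in> cfun_span (\<Union>(\<S> - {X}))"
        unfolding span_ins by blast
      have "z - v \<in> M"
        using cfun.subspace_diff[OF assms(3)] SM[OF XS] z(1) uv(3) sub by blast
      then have "u \<in> M" using uv(1) by simp
      then have "u = 0" using uv(2) disj by blast
      then have "z = v" using uv(1) by simp
      then show ?thesis using ds[OF XS] z(1) uv(3) by blast
    qed
    moreover have "0 \<in> X" using ds[OF XS] by blast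
    ultimately show ?thesis using cfun.span_zero by blast
  qed
  moreover have "cfun_span (\<Union>(insert U \<S>)) = {x + y |x y. x \<in> U \<and> y \<in> M}"
    using span_ins[of \<S>] sp by simp
  ultimately show ?thesis by (simp add: internal_direct_sum_def)
qed

lemma unitary_submodule_decomposition:
  assumes rep: "representation G I \<rho>"
    and unitary: "\<And>g x y. g \<in> carrier G \<Longrightarrow> x \<in> cvecs I \<Longrightarrow> y \<in> cvecs I \<Longrightarrow>
      cinner I (mat_vec I (\<rho> g) x) (mat_vec I (\<rho> g) y) = cinner I x y"
    and "submodule G I \<rho> U"
  shows "\<exists>\<S>. (\<forall>X\<in>\<S>. simple_submodule G I \<rho> X) \<and> internal_direct_sum \<S> U"
  using assms(3)
proof (induction "cfun.dim U" arbitrary: U rule: less_induct)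
  case less
  have fin: "finite I" using rep by (simp add: representation_def)
  obtain F where F: "finite F" "cvecs I \<subseteq> cfun_span F"
    using cvecs_finite_spanning[OF fin] .
  show ?case
  proof (cases "U = {0}")
    case True
    then have "internal_direct_sum {} U" by (simp add: internal_direct_sum_def)
    then show ?thesis by blast
  next
    case False
    then obtain U1 where U1: "simple_submodule G I \<rho> U1" "U1 \<subseteq> U"
      using nonzero_submodule_contains_simple[OF fin less.prems] by blast
    then have sU1: "submodule G I \<rho> U1" and nz: "U1 \<noteq> {0}"
      by (auto simp: simple_submodule_def)
    define U2 where "U2 = {x \<in> U. \<forall>y\<in>U1. cinner I x y = 0}"
    have sU2: "submodule G I \<rho> U2"
      unfolding U2_def using submodule_orthogonal_complement[OF rep unitary less.prems sU1] .
    have sub: "cfun_subspace U" "cfun_subspace U1" "cfun_subspace U2"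
      and UI: "U \<subseteq> cvecs I" "U1 \<subseteq> cvecs I"
      using less.prems sU1 sU2 by (auto simp: submodule_def)
    have disj: "U1 \<inter> U2 = {0}"
    proof -
      have "x = 0" if "x \<in> U1" "x \<in> U2" for x
        using cinner_self_eq_0[OF fin] that UI by (auto simp: U2_def)
      then show ?thesis
        using cfun.subspace_0 sub(2,3) by blast
    qed
    have "U2 \<noteq> U"
      using disj nz U1(2) by blast
    then have "U2 \<subset> U" by (auto simp: U2_def)
    then have "cfun.dim U2 < cfun.dim U"
      using cfun.dim_less_of_psubspace[OF sub(3) _ _ F(1)] UI(1) F(2) by blast
    then obtain \<S> where S: "\<forall>X\<in>\<S>. simple_submodule G I \<rho> X" "internal_direct_sum \<S> U2"
      using less.hyps sU2 by blast
    have "{x + y |x y. x \<in> U1 \<and> y \<in> U2} = U"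
    proof (intro equalityI subsetI)
      fix z assume "z \<in> {x + y |x y. x \<in> U1 \<and> y \<in> U2}"
      then show "z \<in> U"
        using U1(2) cfun.subspace_add[OF sub(1)] by (auto simp: U2_def)
    next
      fix z assume z: "z \<in> U"
      obtain p where p: "p \<in> U1" "\<forall>y\<in>U1. cinner I (z - p) y = 0"
        using cvecs_orthogonal_projection[OF fin sub(2) UI(2)] by blast
      then have "z - p \<in> U2"
        using cfun.subspace_diff[OF sub(1) z] U1(2) by (auto simp: U2_def)
      moreover have "z = p + (z - p)" by simp
      ultimately show "z \<in> {x + y |x y. x \<in> U1 \<and> y \<in> U2}"
        using p(1) by blast
    qed
    then have "internal_direct_sum (insert U1 \<S>) U"
      using internal_direct_sum_insert[OF S(2) sub(2,3) disj nz] by simp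
    then show ?thesis using S(1) U1(1) by blast
  qed
qed

lemma unitary_representation_semisimple:
  assumes rep: "representation G I \<rho>"
    and unitary: "\<And>g x y. g \<in> carrier G \<Longrightarrow> x \<in> cvecs I \<Longrightarrow> y \<in> cvecs I \<Longrightarrow>
      cinner I (mat_vec I (\<rho> g) x) (mat_vec I (\<rho> g) y) = cinner I x y"
  shows "semisimple_module G I \<rho>"
proof -
  have "group_hom G (units_of (mat_monoid I)) \<rho>"
    using rep by (simp add: representation_def)
  then interpret group_hom G "units_of (mat_monoid I)" \<rho> .
  have "\<rho> g \<in> cmats I" if "g \<in> carrier G" for g
    using hom_closed[OF that] by (auto simp: units_of_def Units_def mat_monoid_def)
  then have "submodule G I \<rho> (cvecs I)"
    using subspace_cvecs by (auto simp: submodule_def cvecs_def cmats_def mat_vec_def)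
  then show ?thesis
    using unitary_submodule_decomposition[OF rep unitary] rep
    by (simp add: semisimple_module_def)
qed

section \<open>Permutation matrices\<close>

lemma GL_inv_apply:
  assumes "s \<in> carrier GL"
  shows "s ((inv\<^bsub>GL\<^esub> s) x) = x" "(inv\<^bsub>GL\<^esub> s) (s x) = x"
  using assms unfolding inv_GL[OF assms]
  by (simp_all add: GL_def bij_is_surj surj_f_inv_f bij_is_inj)

lemma GL_inv_mem_iff:
  assumes "s \<in> carrier GL" "s ` I = I"
  shows "(inv\<^bsub>GL\<^esub> s) x \<in> I \<longleftrightarrow> x \<in> I"
  using GL_inv_apply[OF assms(1)] assms(2) by (metis imageE imageI)

lemma perm_matrix_mult_left:
  assumes "finite I" "s \<in> carrier GL" "s ` I = I" "X \<in> cmats I"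
  shows "mat_mult I (perm_matrix I s) X = (\<lambda>\<mu> \<nu>. X ((inv\<^bsub>GL\<^esub> s) \<mu>) \<nu>)"
proof (intro ext)
  fix \<mu> \<nu>
  have "mat_mult I (perm_matrix I s) X \<mu> \<nu> =
      (\<Sum>k\<in>I. if (inv\<^bsub>GL\<^esub> s) \<mu> = k then X k \<nu> else 0)"
    unfolding mat_mult_def using GL_inv_mem_iff[OF assms(2,3)]
    by (intro sum.cong) (auto simp: perm_matrix_def)
  then show "mat_mult I (perm_matrix I s) X \<mu> \<nu> = X ((inv\<^bsub>GL\<^esub> s) \<mu>) \<nu>"
    using assms(1,4) by (auto simp: cmats_def)
qed

lemma perm_matrix_mult_right:
  assumes "finite I" "s \<in> carrier GL" "s ` I = I" "X \<in> cmats I"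
  shows "mat_mult I X (perm_matrix I s) = (\<lambda>\<mu> \<nu>. X \<mu> (s \<nu>))"
proof (intro ext)
  fix \<mu> \<nu>
  have iff: "(inv\<^bsub>GL\<^esub> s) k = \<nu> \<longleftrightarrow> k = s \<nu>" for k
    using GL_inv_apply[OF assms(2)] by metis
  have mem: "s \<nu> \<in> I \<longleftrightarrow> \<nu> \<in> I"
    using GL_inv_mem_iff[OF assms(2,3), of "s \<nu>"] GL_inv_apply[OF assms(2)] by simp
  have "mat_mult I X (perm_matrix I s) \<mu> \<nu> = (\<Sum>k\<in>I. if k = s \<nu> then X \<mu> k else 0)"
    unfolding mat_mult_def using mem
    by (intro sum.cong) (auto simp: perm_matrix_def iff)
  then show "mat_mult I X (perm_matrix I s) \<mu> \<nu> = X \<mu> (s \<nu>)"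
    using assms(1,4) by (auto simp: cmats_def)
qed

lemma perm_matrix_in_cmats: "perm_matrix I s \<in> cmats I"
  by (auto simp: perm_matrix_def cmats_def)

lemma perm_matrix_compose:
  assumes "finite I" "s \<in> carrier GL" "s ` I = I" "t \<in> carrier GL"
  shows "perm_matrix I (s \<otimes>\<^bsub>GL\<^esub> t) = mat_mult I (perm_matrix I s) (perm_matrix I t)"
proof -
  have "inv\<^bsub>GL\<^esub> (s \<otimes>\<^bsub>GL\<^esub> t) = inv\<^bsub>GL\<^esub> t \<otimes>\<^bsub>GL\<^esub> inv\<^bsub>GL\<^esub> s"
    using group.inv_mult_group[OF group_GL assms(2,4)] .
  then have inv: "(inv\<^bsub>GL\<^esub> (s \<otimes>\<^bsub>GL\<^esub> t)) x = (inv\<^bsub>GL\<^esub> t) ((inv\<^bsub>GL\<^esub> s) x)" for x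
    by (simp add: GL_def)
  show ?thesis
    unfolding perm_matrix_mult_left[OF assms(1-3) perm_matrix_in_cmats]
    using GL_inv_mem_iff[OF assms(2,3)] by (auto simp: perm_matrix_def inv intro!: ext)
qed

lemma perm_matrix_one: "perm_matrix I \<one>\<^bsub>GL\<^esub> = mat_one I"
  unfolding perm_matrix_def mat_one_def monoid.inv_one[OF group.is_monoid[OF group_GL]]
  by (auto simp: GL_def intro!: ext)

lemma perm_matrix_representation:
  assumes "finite I" "subgroup W GL" "\<And>s. s \<in> W \<Longrightarrow> s ` I = I"
  shows "representation (GL\<lparr>carrier := W\<rparr>) I (perm_matrix I)"
proof -
  interpret W: subgroup W GL by fact
  have "perm_matrix I s \<in> Units (mat_monoid I)" if s: "s \<in> W" for s
  proof -
    have i: "inv\<^bsub>GL\<^esub> s \<in> W" using s by simp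
    have "mat_mult I (perm_matrix I s) (perm_matrix I (inv\<^bsub>GL\<^esub> s)) = mat_one I"
      using perm_matrix_compose[OF assms(1) _ assms(3)] s i group.r_inv[OF group_GL]
      by (metis W.mem_carrier perm_matrix_one)
    moreover have "mat_mult I (perm_matrix I (inv\<^bsub>GL\<^esub> s)) (perm_matrix I s) = mat_one I"
      using perm_matrix_compose[OF assms(1) _ assms(3)] s i group.l_inv[OF group_GL]
      by (metis W.mem_carrier perm_matrix_one)
    ultimately show ?thesis
      using perm_matrix_in_cmats by (auto simp: Units_def mat_monoid_def)
  qed
  then have "perm_matrix I \<in> hom (GL\<lparr>carrier := W\<rparr>) (units_of (mat_monoid I))"
    using perm_matrix_compose[OF assms(1) _ assms(3)]
    by (auto simp: hom_def units_of_def mat_monoid_def)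
  moreover have "group (GL\<lparr>carrier := W\<rparr>)"
    using W.subgroup_is_group[OF group_GL] .
  moreover have "group (units_of (mat_monoid I))"
    using monoid.units_group[OF monoid_mat_monoid[OF assms(1)]] .
  ultimately show ?thesis
    using assms(1) by (simp add: representation_def group_hom_def group_hom_axioms_def)
qed

lemma perm_matrix_unitary:
  assumes "finite I" "s \<in> carrier GL" "s ` I = I"
  shows "cinner I (mat_vec I (perm_matrix I s) x) (mat_vec I (perm_matrix I s) y) = cinner I x y"
proof -
  have inj: "inj_on s I" using assms(2)
    by (auto simp: GL_def intro: inj_on_subset[OF bij_is_inj])
  have "cinner I (mat_vec I (perm_matrix I s) x) (mat_vec I (perm_matrix I s) y) =
      (\<Sum>i\<in>s ` I. x ((inv\<^bsub>GL\<^esub> s) i) * cnj (y ((inv\<^bsub>GL\<^esub> s) i)))"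
    unfolding cinner_def assms(3) by (intro sum.cong) (simp_all add: mat_vec_perm_matrix assms)
  also have "\<dots> = cinner I x y"
    by (simp add: sum.reindex[OF inj] cinner_def GL_inv_apply[OF assms(2)])
  finally show ?thesis .
qed

lemma toep_act_eq_conjugation:
  assumes "finite I" "subgroup W GL" "\<And>s. s \<in> W \<Longrightarrow> s ` I = I" "s \<in> W" "X \<in> cmats I"
  shows "s \<star> X =
    mat_mult I (mat_mult I (perm_matrix I s) X) (perm_matrix I (inv\<^bsub>GL\<^esub> s))"
proof -
  interpret W: subgroup W GL by fact
  have s: "s \<in> carrier GL" "s ` I = I" using assms(3,4) by auto
  have i: "inv\<^bsub>GL\<^esub> s \<in> carrier GL" "(inv\<^bsub>GL\<^esub> s) ` I = I"
    using assms(3,4) by auto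
  have "(\<lambda>\<mu> \<nu>. X ((inv\<^bsub>GL\<^esub> s) \<mu>) \<nu>) \<in> cmats I"
    using assms(5) GL_inv_mem_iff[OF s] by (auto simp: cmats_def)
  then show ?thesis
    by (simp add: perm_matrix_mult_left[OF assms(1) s assms(5)]
        perm_matrix_mult_right[OF assms(1) i] toep_act_def)
qed

section \<open>The module of vectors indexed by the truncated lattice\<close>

theorem proposition2p4:
  fixes \<Omega> :: "'v::real_inner set" and d :: nat and W :: "('v \<Rightarrow> 'v) set"
  assumes "\<exists>B::'v set. finite B \<and> span B = UNIV"
    and "full_lattice \<Omega>"
    and "subgroup W GL"
    and "finite W"
    and "\<And>s. s \<in> W \<Longrightarrow> s ` \<Omega> = \<Omega>"
    and "\<And>s. s \<in> W \<Longrightarrow> s ` lattice_trunc \<Omega> d = lattice_trunc \<Omega> d"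
  shows "semisimple_module (GL\<lparr>carrier := W\<rparr>) (lattice_trunc \<Omega> d)
           (perm_matrix (lattice_trunc \<Omega> d)) \<and>
         (\<forall>X\<in>Toep \<Omega> d. \<forall>s\<in>W.
            s \<star> X =
              mat_mult (lattice_trunc \<Omega> d)
                (mat_mult (lattice_trunc \<Omega> d) (perm_matrix (lattice_trunc \<Omega> d) s) X)
                (perm_matrix (lattice_trunc \<Omega> d) (inv\<^bsub>GL\<^esub> s)))"
proof (intro conjI ballI)
  interpret W: subgroup W GL by fact
  have fin: "finite (lattice_trunc \<Omega> d)"
    using finite_lattice_trunc[OF assms(2)] .
  show "semisimple_module (GL\<lparr>carrier := W\<rparr>) (lattice_trunc \<Omega> d)
      (perm_matrix (lattice_trunc \<Omega> d))"
  proof (rule unitary_representation_semisimple)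
    show "representation (GL\<lparr>carrier := W\<rparr>) (lattice_trunc \<Omega> d) (perm_matrix (lattice_trunc \<Omega> d))"
      using perm_matrix_representation[OF fin assms(3,6)] .
  qed (simp add: perm_matrix_unitary[OF fin] assms(6))
  show "s \<star> X =
      mat_mult (lattice_trunc \<Omega> d)
        (mat_mult (lattice_trunc \<Omega> d) (perm_matrix (lattice_trunc \<Omega> d) s) X)
        (perm_matrix (lattice_trunc \<Omega> d) (inv\<^bsub>GL\<^esub> s))"
    if "X \<in> Toep \<Omega> d" "s \<in> W" for X s
    using toep_act_eq_conjugation[OF fin assms(3,6) that(2)] that(1) by (simp add: Toep_def)
qed

end
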